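(* For each of the following four conditions there exist a $C^*$-algebra $A$ and a map $\varphi : A^+ \to A^+$ (not assumed linear or additive) satisfying it: (1) $\varphi$ is concave and $\varphi$ is not supercongruent. (2) $\varphi$ is monotone, $\varphi$ is not concave, and $\varphi$ is not supercongruent. (3) $\varphi$ is not monotone, and $\varphi$ is supercongruent. (4) $\varphi$ is not monotone, and $\varphi$ is not supercongruent.
   Context: For a $C^*$-algebra $A$, $A^+$ denotes the cone of all positive elements. A map $\varphi : A^+ \to A^+$ is called monotone if $x \leq y$ implies $\varphi(x) \leq \varphi(y)$ for all $x, y \in A^+$; supercongruent if $c\varphi(a)c \leq \varphi(cac)$ for any $a \in A^+$ and any contraction $c \in A^+$; concave if $\varphi(tx + (1-t)y) \geq t\varphi(x) + (1-t)\varphi(y)$ for all $x, y \in A^+$ and $t \in [0,1]$. *)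

theory Defs
  imports
    "HOL-Analysis.Abstract_Metric_Spaces"
    "HOL-Algebra.Algebraic_Closure_Type"
begin

(* C*-algebras are represented by records, so that one can quantify over them.  They are not
   assumed to be unital: the field "one", inherited from the ring record that the module record
   extends, is unconstrained and not used. *)

record 'a cstar = "(complex, 'a) module" +
  star :: "'a \<Rightarrow> 'a"
  nrm :: "'a \<Rightarrow> real"

locale cstar_algebra = module "ring_of_type_algebra :: complex ring" A
  for A :: "'a cstar" (structure) +
  assumes mult_closed: "\<lbrakk>x \<in> carrier A; y \<in> carrier A\<rbrakk> \<Longrightarrow> x \<otimes> y \<in> carrier A"
    and mult_assoc: "\<lbrakk>x \<in> carrier A; y \<in> carrier A; z \<in> carrier A\<rbrakk>
      \<Longrightarrow> (x \<otimes> y) \<otimes> z = x \<otimes> (y \<otimes> z)"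
    and mult_add_left: "\<lbrakk>x \<in> carrier A; y \<in> carrier A; z \<in> carrier A\<rbrakk>
      \<Longrightarrow> (x \<oplus> y) \<otimes> z = (x \<otimes> z) \<oplus> (y \<otimes> z)"
    and mult_add_right: "\<lbrakk>x \<in> carrier A; y \<in> carrier A; z \<in> carrier A\<rbrakk>
      \<Longrightarrow> x \<otimes> (y \<oplus> z) = (x \<otimes> y) \<oplus> (x \<otimes> z)"
    and smult_mult_left: "\<lbrakk>x \<in> carrier A; y \<in> carrier A\<rbrakk> \<Longrightarrow> (s \<odot> x) \<otimes> y = s \<odot> (x \<otimes> y)"
    and smult_mult_right: "\<lbrakk>x \<in> carrier A; y \<in> carrier A\<rbrakk> \<Longrightarrow> x \<otimes> (s \<odot> y) = s \<odot> (x \<otimes> y)"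
    and star_closed: "x \<in> carrier A \<Longrightarrow> star A x \<in> carrier A"
    and star_star: "x \<in> carrier A \<Longrightarrow> star A (star A x) = x"
    and star_add: "\<lbrakk>x \<in> carrier A; y \<in> carrier A\<rbrakk> \<Longrightarrow> star A (x \<oplus> y) = star A x \<oplus> star A y"
    and star_smult: "x \<in> carrier A \<Longrightarrow> star A (s \<odot> x) = cnj s \<odot> star A x"
    and star_mult: "\<lbrakk>x \<in> carrier A; y \<in> carrier A\<rbrakk> \<Longrightarrow> star A (x \<otimes> y) = star A y \<otimes> star A x"
    and nrm_nonneg: "x \<in> carrier A \<Longrightarrow> 0 \<le> nrm A x"
    and nrm_eq_0: "x \<in> carrier A \<Longrightarrow> nrm A x = 0 \<longleftrightarrow> x = \<zero>"
    and nrm_triangle: "\<lbrakk>x \<in> carrier A; y \<in> carrier A\<rbrakk> \<Longrightarrow> nrm A (x \<oplus> y) \<le> nrm A x + nrm A y"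
    and nrm_smult: "x \<in> carrier A \<Longrightarrow> nrm A (s \<odot> x) = cmod s * nrm A x"
    and nrm_mult: "\<lbrakk>x \<in> carrier A; y \<in> carrier A\<rbrakk> \<Longrightarrow> nrm A (x \<otimes> y) \<le> nrm A x * nrm A y"
    and complete: "Metric_space.mcomplete (carrier A) (\<lambda>x y. nrm A (x \<ominus> y))"
    and cstar_identity: "x \<in> carrier A \<Longrightarrow> nrm A (star A x \<otimes> x) = (nrm A x)\<^sup>2"

(* The pair (a, s) stands for a + s1. *)

definition unitization :: "'a cstar \<Rightarrow> ('a \<times> complex) ring" where
  "unitization A = \<lparr>
     carrier = carrier A \<times> UNIV,
     monoid.mult = (\<lambda>(a, s) (b, t).
       (((a \<otimes>\<^bsub>A\<^esub> b) \<oplus>\<^bsub>A\<^esub> (t \<odot>\<^bsub>A\<^esub> a)) \<oplus>\<^bsub>A\<^esub> (s \<odot>\<^bsub>A\<^esub> b), s * t)),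
     one = (\<zero>\<^bsub>A\<^esub>, 1),
     zero = (\<zero>\<^bsub>A\<^esub>, 0),
     add = (\<lambda>(a, s) (b, t). (a \<oplus>\<^bsub>A\<^esub> b, s + t))\<rparr>"

(* The set of all l such that l1 - a is not invertible in the unitization.  If A already has a
   unit, this is the spectrum of a in A together with 0; the additional point 0 is irrelevant for
   positivity. *)

definition spectrum :: "'a cstar \<Rightarrow> 'a \<Rightarrow> complex set" where
  "spectrum A a = {l. (\<ominus>\<^bsub>A\<^esub> a, l) \<notin> Units (unitization A)}"

definition positives :: "'a cstar \<Rightarrow> 'a set" where
  "positives A = {a \<in> carrier A. star A a = a \<and> spectrum A a \<subseteq> complex_of_real ` {0..}}"

definition cle :: "'a cstar \<Rightarrow> 'a \<Rightarrow> 'a \<Rightarrow> bool" where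
  "cle A x y \<longleftrightarrow> y \<ominus>\<^bsub>A\<^esub> x \<in> positives A"

definition cstar_monotone :: "'a cstar \<Rightarrow> ('a \<Rightarrow> 'a) \<Rightarrow> bool" where
  "cstar_monotone A \<phi> \<longleftrightarrow>
     (\<forall>x\<in>positives A. \<forall>y\<in>positives A. cle A x y \<longrightarrow> cle A (\<phi> x) (\<phi> y))"

definition cstar_supercongruent :: "'a cstar \<Rightarrow> ('a \<Rightarrow> 'a) \<Rightarrow> bool" where
  "cstar_supercongruent A \<phi> \<longleftrightarrow>
     (\<forall>a\<in>positives A. \<forall>c\<in>positives A. nrm A c \<le> 1 \<longrightarrow>
        cle A ((c \<otimes>\<^bsub>A\<^esub> \<phi> a) \<otimes>\<^bsub>A\<^esub> c) (\<phi> ((c \<otimes>\<^bsub>A\<^esub> a) \<otimes>\<^bsub>A\<^esub> c)))"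

definition cstar_concave :: "'a cstar \<Rightarrow> ('a \<Rightarrow> 'a) \<Rightarrow> bool" where
  "cstar_concave A \<phi> \<longleftrightarrow>
     (\<forall>x\<in>positives A. \<forall>y\<in>positives A. \<forall>t\<in>{0..1::real}.
        cle A ((complex_of_real t \<odot>\<^bsub>A\<^esub> \<phi> x) \<oplus>\<^bsub>A\<^esub> (complex_of_real (1 - t) \<odot>\<^bsub>A\<^esub> \<phi> y))
              (\<phi> ((complex_of_real t \<odot>\<^bsub>A\<^esub> x) \<oplus>\<^bsub>A\<^esub> (complex_of_real (1 - t) \<odot>\<^bsub>A\<^esub> y))))"

(* HOL cannot quantify existentially over types, so the elements of a C*-algebra are drawn from a
   fixed type.  Its cardinality is that of the continuum, so every separable C*-algebra has an
   isomorphic copy (with arbitrary operations) whose carrier is a subset of this type. *)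

type_synonym point = "nat \<Rightarrow> complex"

end

theory Submission
  imports Defs "HOL-Library.Complex_Order"
begin

text \<open>Everything happens in the commutative C*-algebras \<open>\<complex>\<^sup>N\<close> with \<open>N \<le> 2\<close>.
  (1) The coordinate swap of \<open>\<complex>\<^sup>2\<close> is linear, hence concave, but compressing \<open>(0, 1)\<close> by the
  projection \<open>(1, 0)\<close> gives \<open>0\<close>, whereas compressing its image \<open>(1, 0)\<close> changes nothing.
  In \<open>\<complex>\<close>, supercongruence of \<open>g\<close> says \<open>c\<^sup>2 g(a) \<le> g(c\<^sup>2 a)\<close> for \<open>0 \<le> c \<le> 1\<close>, which
  is refuted by (2) \<open>g(x) = x\<^sup>2\<close> and (4) the indicator function of \<open>1\<close>, and satisfied by
  (3) the indicator function of \<open>0\<close>.\<close>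

section \<open>The C*-algebra of complex tuples\<close>

text \<open>An \<open>N\<close>-tuple is extended by zero to a sequence. The operations discard the entries from
  \<open>N\<close> on, because \<^locale>\<open>Metric_space\<close> asks for a distance that is nonnegative and symmetric also
  outside the carrier; with truncation, the additive inverse is meaningful everywhere.\<close>

definition tuple_alg :: "nat \<Rightarrow> point cstar" where
  "tuple_alg N = \<lparr>
     carrier = {x. \<forall>i\<ge>N. x i = 0},
     monoid.mult = (\<lambda>x y i. if i < N then x i * y i else 0),
     one = (\<lambda>i. if i < N then 1 else 0),
     zero = (\<lambda>i. 0),
     add = (\<lambda>x y i. if i < N then x i + y i else 0),
     module.smult = (\<lambda>s x i. if i < N then s * x i else 0),
     star = (\<lambda>x i. if i < N then cnj (x i) else 0),
     nrm = (\<lambda>x. Max (insert 0 ((\<lambda>i. cmod (x i)) ` {..<N})))\<rparr>"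

lemma tuple_alg_simps [simp]:
  "x \<in> carrier (tuple_alg N) \<longleftrightarrow> (\<forall>i\<ge>N. x i = 0)"
  "x \<otimes>\<^bsub>tuple_alg N\<^esub> y = (\<lambda>i. if i < N then x i * y i else 0)"
  "\<zero>\<^bsub>tuple_alg N\<^esub> = (\<lambda>i. 0)"
  "x \<oplus>\<^bsub>tuple_alg N\<^esub> y = (\<lambda>i. if i < N then x i + y i else 0)"
  "s \<odot>\<^bsub>tuple_alg N\<^esub> x = (\<lambda>i. if i < N then s * x i else 0)"
  "star (tuple_alg N) x = (\<lambda>i. if i < N then cnj (x i) else 0)"
  by (simp_all add: tuple_alg_def)

text \<open>This holds for every sequence: the truncated sum fixes the inverse below
  \<open>N\<close>, and membership in the carrier fixes it from \<open>N\<close> on.\<close>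

lemma tuple_alg_a_inv [simp]:
  "\<ominus>\<^bsub>tuple_alg N\<^esub> x = (\<lambda>i. if i < N then - x i else 0)"
  unfolding a_inv_def m_inv_def
proof (rule the_equality, goal_cases)
  case 1
  then show ?case by (simp add: fun_eq_iff)
next
  case (2 y)
  then have "y i = (if i < N then - x i else 0)" for i
    by (cases "i < N") (auto simp: fun_eq_iff eq_neg_iff_add_eq_0 split: if_splits)
  then show ?case by blast
qed

lemma tuple_alg_minus [simp]:
  "x \<ominus>\<^bsub>tuple_alg N\<^esub> y = (\<lambda>i. if i < N then x i - y i else 0)"
  by (auto simp: a_minus_def)

section \<open>The maximum norm\<close>

text \<open>Reduces norm estimates to single entries. The conjunct \<open>0 \<le> r\<close> stems
  from the inserted \<open>0\<close>, which also gives the empty tuple norm 0.\<close>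

lemma nrm_tuple_alg_le_iff:
  "nrm (tuple_alg N) x \<le> r \<longleftrightarrow> 0 \<le> r \<and> (\<forall>i<N. cmod (x i) \<le> r)"
  by (auto simp: tuple_alg_def)

lemma cmod_le_nrm_tuple_alg: "i < N \<Longrightarrow> cmod (x i) \<le> nrm (tuple_alg N) x"
  and nrm_tuple_alg_nonneg: "0 \<le> nrm (tuple_alg N) x"
  using nrm_tuple_alg_le_iff[of N x "nrm (tuple_alg N) x"] by auto

lemma nrm_tuple_alg_cong:
  "(\<And>i. i < N \<Longrightarrow> cmod (x i) = cmod (y i)) \<Longrightarrow> nrm (tuple_alg N) x = nrm (tuple_alg N) y"
  by (simp add: tuple_alg_def cong: image_cong_simp)

lemma nrm_tuple_alg_eq_0_iff: "nrm (tuple_alg N) x = 0 \<longleftrightarrow> (\<forall>i<N. x i = 0)"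
  using nrm_tuple_alg_le_iff[of N x 0] nrm_tuple_alg_nonneg[of N x] by auto

lemma nrm_tuple_alg_triangle:
  "nrm (tuple_alg N) (x \<oplus>\<^bsub>tuple_alg N\<^esub> y) \<le> nrm (tuple_alg N) x + nrm (tuple_alg N) y"
  unfolding nrm_tuple_alg_le_iff
  by (auto simp: nrm_tuple_alg_nonneg
      intro!: norm_triangle_le add_mono cmod_le_nrm_tuple_alg)

lemma nrm_tuple_alg_mult:
  "nrm (tuple_alg N) (x \<otimes>\<^bsub>tuple_alg N\<^esub> y) \<le> nrm (tuple_alg N) x * nrm (tuple_alg N) y"
  unfolding nrm_tuple_alg_le_iff
  by (auto simp: nrm_tuple_alg_nonneg norm_mult intro!: mult_mono' cmod_le_nrm_tuple_alg)

text \<open>Multiplication by \<open>cmod s \<ge> 0\<close> is monotone, so it commutes with the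
  maximum.\<close>

lemma nrm_tuple_alg_smult:
  "nrm (tuple_alg N) (s \<odot>\<^bsub>tuple_alg N\<^esub> x) = cmod s * nrm (tuple_alg N) x"
proof -
  have "cmod s * Max (insert 0 ((\<lambda>i. cmod (x i)) ` {..<N}))
      = Max ((*) (cmod s) ` insert 0 ((\<lambda>i. cmod (x i)) ` {..<N}))"
    by (intro mono_Max_commute monoI mult_left_mono) auto
  then show ?thesis
    by (simp add: tuple_alg_def image_image norm_mult cong: image_cong_simp)
qed

lemma nrm_tuple_alg_cstar_identity:
  "nrm (tuple_alg N) (star (tuple_alg N) x \<otimes>\<^bsub>tuple_alg N\<^esub> x) = (nrm (tuple_alg N) x)\<^sup>2"
    (is "?l = _")
proof (rule antisym)
  show "?l \<le> (nrm (tuple_alg N) x)\<^sup>2"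
    unfolding nrm_tuple_alg_le_iff power2_eq_square
    by (auto simp: norm_mult intro!: mult_mono' cmod_le_nrm_tuple_alg)
  \<comment> \<open>Each squared modulus is the modulus of an entry of the product, so square roots
    bound every entry of \<open>x\<close>.\<close>
  have "(cmod (x i))\<^sup>2 \<le> ?l" if "i < N" for i
    using cmod_le_nrm_tuple_alg[OF that, of "star (tuple_alg N) x \<otimes>\<^bsub>tuple_alg N\<^esub> x"] that
    by (simp add: norm_mult power2_eq_square)
  then have "nrm (tuple_alg N) x \<le> sqrt ?l"
    unfolding nrm_tuple_alg_le_iff
    by (auto simp del: tuple_alg_simps simp: nrm_tuple_alg_nonneg intro: real_le_rsqrt)
  then show "(nrm (tuple_alg N) x)\<^sup>2 \<le> ?l"
    using nrm_tuple_alg_nonneg by (metis real_sqrt_le_iff real_sqrt_unique)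
qed

section \<open>The norm metric and its completeness\<close>

lemma metric_space_tuple_alg:
  "Metric_space (carrier (tuple_alg N)) (\<lambda>x y. nrm (tuple_alg N) (x \<ominus>\<^bsub>tuple_alg N\<^esub> y))"
proof
  show "nrm (tuple_alg N) (x \<ominus>\<^bsub>tuple_alg N\<^esub> y) = nrm (tuple_alg N) (y \<ominus>\<^bsub>tuple_alg N\<^esub> x)" for x y
    by (rule nrm_tuple_alg_cong) (simp add: norm_minus_commute)
  show "nrm (tuple_alg N) (x \<ominus>\<^bsub>tuple_alg N\<^esub> y) = 0 \<longleftrightarrow> x = y"
    if "x \<in> carrier (tuple_alg N)" "y \<in> carrier (tuple_alg N)" for x y
    using that by (auto simp: nrm_tuple_alg_eq_0_iff fun_eq_iff) (metis not_le)
  show "nrm (tuple_alg N) (x \<ominus>\<^bsub>tuple_alg N\<^esub> z)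
      \<le> nrm (tuple_alg N) (x \<ominus>\<^bsub>tuple_alg N\<^esub> y) + nrm (tuple_alg N) (y \<ominus>\<^bsub>tuple_alg N\<^esub> z)" for x y z
  proof -
    have "x \<ominus>\<^bsub>tuple_alg N\<^esub> z = (x \<ominus>\<^bsub>tuple_alg N\<^esub> y) \<oplus>\<^bsub>tuple_alg N\<^esub> (y \<ominus>\<^bsub>tuple_alg N\<^esub> z)"
      by auto
    then show ?thesis by (metis nrm_tuple_alg_triangle)
  qed
qed (rule nrm_tuple_alg_nonneg)

lemma mcomplete_tuple_alg:
  "Metric_space.mcomplete (carrier (tuple_alg N))
     (\<lambda>x y. nrm (tuple_alg N) (x \<ominus>\<^bsub>tuple_alg N\<^esub> y))"
  (is "Metric_space.mcomplete ?M ?d")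
proof -
  note defs = Metric_space.MCauchy_def[OF metric_space_tuple_alg]
    Metric_space.limit_metric_sequentially[OF metric_space_tuple_alg]
  show ?thesis
    unfolding Metric_space.mcomplete_def[OF metric_space_tuple_alg]
  proof (intro allI impI)
    fix \<sigma> assume "Metric_space.MCauchy ?M ?d \<sigma>"
    then have \<sigma>: "range \<sigma> \<subseteq> ?M"
      "\<forall>e>0. \<exists>K. \<forall>m n. K \<le> m \<longrightarrow> K \<le> n \<longrightarrow> ?d (\<sigma> m) (\<sigma> n) < e"
      unfolding defs by iprover+
    \<comment> \<open>One \<open>K\<close> serves all coordinates, so the coordinatewise limits
      below are limits in norm.\<close>
    have uniform: "\<exists>K. \<forall>m\<ge>K. \<forall>n\<ge>K. \<forall>i<N. cmod (\<sigma> m i - \<sigma> n i) < e"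
      if pos: "0 < e" for e
    proof -
      obtain K where K: "\<And>m n. K \<le> m \<Longrightarrow> K \<le> n \<Longrightarrow> nrm (tuple_alg N) (\<sigma> m \<ominus>\<^bsub>tuple_alg N\<^esub> \<sigma> n) < e"
        using \<sigma>(2) pos by blast
      have "cmod (\<sigma> m i - \<sigma> n i) < e" if "K \<le> m" "K \<le> n" "i < N" for m n i
        using le_less_trans[OF cmod_le_nrm_tuple_alg[OF that(3)] K[OF that(1,2)]] that(3) by simp
      then show ?thesis by blast
    qed
    then have "convergent (\<lambda>n. \<sigma> n i)" if "i < N" for i
      unfolding Cauchy_convergent_iff[symmetric] Cauchy_def dist_norm using that by meson
    then obtain l where l: "\<And>i. i < N \<Longrightarrow> (\<lambda>n. \<sigma> n i) \<longlonglongrightarrow> l i"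
      unfolding convergent_def by metis
    define x where "x i = (if i < N then l i else 0)" for i
    have "limitin (Metric_space.mtopology ?M ?d) \<sigma> x sequentially"
      unfolding defs
    proof (intro conjI allI impI)
      show "x \<in> carrier (tuple_alg N)" by (simp add: x_def)
      fix e :: real assume "0 < e"
      then obtain K where K: "\<And>m n i. K \<le> m \<Longrightarrow> K \<le> n \<Longrightarrow> i < N \<Longrightarrow> cmod (\<sigma> m i - \<sigma> n i) < e / 2"
        using uniform[of "e / 2"] by auto
      \<comment> \<open>Letting \<open>n\<close> tend to infinity weakens \<open><\<close> to
        \<open>\<le>\<close>; starting from \<open>e / 2\<close> keeps the final bound
        strict.\<close>
      have "cmod (\<sigma> m i - x i) \<le> e / 2" if "K \<le> m" "i < N" for m i
      proof (rule tendsto_upperbound)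
        show "(\<lambda>n. cmod (\<sigma> m i - \<sigma> n i)) \<longlonglongrightarrow> cmod (\<sigma> m i - x i)"
          using l[OF that(2)] that(2) by (auto simp: x_def intro!: tendsto_intros)
        show "\<forall>\<^sub>F n in sequentially. cmod (\<sigma> m i - \<sigma> n i) \<le> e / 2"
          using eventually_ge_at_top[of K] by eventually_elim (use K that in \<open>auto intro: less_imp_le\<close>)
      qed simp
      then have "nrm (tuple_alg N) (\<sigma> m \<ominus>\<^bsub>tuple_alg N\<^esub> x) \<le> e / 2" if "K \<le> m" for m
        unfolding nrm_tuple_alg_le_iff using that \<open>0 < e\<close> by simp
      then have "nrm (tuple_alg N) (\<sigma> m \<ominus>\<^bsub>tuple_alg N\<^esub> x) < e" if "K \<le> m" for m
        using that \<open>0 < e\<close> by fastforce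
      moreover have "\<sigma> m \<in> carrier (tuple_alg N)" for m
        using \<sigma>(1) by blast
      ultimately show "\<exists>K. \<forall>m\<ge>K. \<sigma> m \<in> carrier (tuple_alg N)
          \<and> nrm (tuple_alg N) (\<sigma> m \<ominus>\<^bsub>tuple_alg N\<^esub> x) < e"
        by blast
    qed
    then show "\<exists>x. limitin (Metric_space.mtopology ?M ?d) \<sigma> x sequentially" by blast
  qed
qed

lemma module_tuple_alg: "module (ring_of_type_algebra :: complex ring) (tuple_alg N)"
proof (rule moduleI)
  show "cring (ring_of_type_algebra :: complex ring)"
    by (rule cring_from_type_algebra)
  show "abelian_group (tuple_alg N)"
  proof (rule abelian_groupI)
    fix x assume "x \<in> carrier (tuple_alg N)"
    then show "\<exists>y\<in>carrier (tuple_alg N). y \<oplus>\<^bsub>tuple_alg N\<^esub> x = \<zero>\<^bsub>tuple_alg N\<^esub>"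
      by (intro bexI[of _ "\<ominus>\<^bsub>tuple_alg N\<^esub> x"]) auto
  qed (auto simp: fun_eq_iff)
qed (auto simp: ring_of_type_algebra_def fun_eq_iff algebra_simps)

lemma cstar_algebra_tuple_alg: "cstar_algebra (tuple_alg N)"
proof (intro cstar_algebra.intro cstar_algebra_axioms.intro module_tuple_alg)
  show "nrm (tuple_alg N) x = 0 \<longleftrightarrow> x = \<zero>\<^bsub>tuple_alg N\<^esub>" if "x \<in> carrier (tuple_alg N)" for x
    using that by (auto simp: nrm_tuple_alg_eq_0_iff fun_eq_iff) (metis not_le)
qed (rule mcomplete_tuple_alg nrm_tuple_alg_nonneg nrm_tuple_alg_triangle nrm_tuple_alg_mult
  nrm_tuple_alg_smult nrm_tuple_alg_cstar_identity | force simp: fun_eq_iff algebra_simps)+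

section \<open>Positive tuples\<close>

text \<open>The value \<open>0\<close> that every tuple takes from index \<open>N\<close> on matches the point \<open>0\<close> that the
  unitization adds to the spectrum.\<close>

lemma spectrum_tuple_alg:
  assumes "a \<in> carrier (tuple_alg N)"
  shows "spectrum (tuple_alg N) a = range a"
proof -
  have "(\<ominus>\<^bsub>tuple_alg N\<^esub> a, l) \<in> Units (unitization (tuple_alg N)) \<longleftrightarrow> l \<notin> range a" for l
  proof
    assume "(\<ominus>\<^bsub>tuple_alg N\<^esub> a, l) \<in> Units (unitization (tuple_alg N))"
    then obtain b t where "(\<ominus>\<^bsub>tuple_alg N\<^esub> a, l) \<otimes>\<^bsub>unitization (tuple_alg N)\<^esub> (b, t)
        = \<one>\<^bsub>unitization (tuple_alg N)\<^esub>"
      unfolding Units_def by fast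
    then have lt: "l * t = 1" and "\<And>i. i < N \<Longrightarrow> - a i * b i + t * - a i + l * b i = 0"
      by (auto simp: unitization_def fun_eq_iff split: if_splits)
    \<comment> \<open>\<open>b i + t\<close> is entry \<open>i\<close> of the inverse. For
      \<open>i \<ge> N\<close>, where \<open>a i = 0\<close>, the equation \<open>l * t = 1\<close>
      takes over.\<close>
    then have "(l - a i) * (b i + t) = 1" if "i < N" for i
      using that by (simp add: algebra_simps)
    then have "l \<noteq> a i" for i
      using lt assms by (cases "i < N") force+
    then show "l \<notin> range a" by blast
  next
    assume l: "l \<notin> range a"
    then have "l \<noteq> a i" for i by blast
    moreover have "a N = 0" using assms by simp
    ultimately have nz: "l \<noteq> 0" "l - a i \<noteq> 0" for i by (metis, simp)
    \<comment> \<open>Chosen so that \<open>b i + 1 / l\<close> is the reciprocal of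
      \<open>l - a i\<close>; the scalar part of the inverse must be \<open>1 / l\<close>.\<close>
    define b where "b = (\<lambda>i. if i < N then 1 / (l - a i) - 1 / l else 0)"
    have inverse: "- a i * b i + 1 / l * - a i + l * b i = 0" if "i < N" for i
    proof -
      have "- a i * b i + 1 / l * - a i + l * b i = (l - a i) * b i - a i / l"
        by (simp add: algebra_simps)
      also have "\<dots> = 0"
        using nz that by (simp add: b_def right_diff_distrib) (simp add: diff_divide_distrib)
      finally show ?thesis .
    qed
    have "(b, 1 / l) \<otimes>\<^bsub>unitization (tuple_alg N)\<^esub> (\<ominus>\<^bsub>tuple_alg N\<^esub> a, l)
        = \<one>\<^bsub>unitization (tuple_alg N)\<^esub>"
      and "(\<ominus>\<^bsub>tuple_alg N\<^esub> a, l) \<otimes>\<^bsub>unitization (tuple_alg N)\<^esub> (b, 1 / l)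
        = \<one>\<^bsub>unitization (tuple_alg N)\<^esub>"
      using inverse nz(1) by (auto simp: unitization_def fun_eq_iff algebra_simps)
    moreover have "(b, 1 / l) \<in> carrier (unitization (tuple_alg N))"
      "(\<ominus>\<^bsub>tuple_alg N\<^esub> a, l) \<in> carrier (unitization (tuple_alg N))"
      by (auto simp: unitization_def b_def)
    ultimately show "(\<ominus>\<^bsub>tuple_alg N\<^esub> a, l) \<in> Units (unitization (tuple_alg N))"
      unfolding Units_def by blast
  qed
  then show ?thesis by (auto simp: spectrum_def)
qed

lemma complex_nonneg_iff: "(0 :: complex) \<le> z \<longleftrightarrow> z \<in> complex_of_real ` {0..}"
  by (auto simp: less_eq_complex_def image_iff complex_eq_iff)

lemma positives_tuple_alg:
  "a \<in> positives (tuple_alg N) \<longleftrightarrow> (\<forall>i\<ge>N. a i = 0) \<and> (\<forall>i<N. 0 \<le> a i)"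
proof (cases "\<forall>i\<ge>N. a i = 0")
  case True
  then have "spectrum (tuple_alg N) a = range a"
    by (simp add: spectrum_tuple_alg)
  moreover have "range a \<subseteq> complex_of_real ` {0..} \<longleftrightarrow> (\<forall>i<N. 0 \<le> a i)"
    using True unfolding image_subset_iff complex_nonneg_iff[symmetric] by (metis UNIV_I leI order_refl)
  \<comment> \<open>In the order on complex numbers \<open>0 \<le> z\<close> forces \<open>z\<close>
    to be real, so self-adjointness comes for free.\<close>
  moreover have "star (tuple_alg N) a = a" if "\<forall>i<N. 0 \<le> a i"
    using that True by (auto simp: fun_eq_iff less_eq_complex_def complex_eq_iff not_less)
  ultimately show ?thesis
    using True by (auto simp: positives_def)
qed (auto simp: positives_def)

lemma cle_tuple_alg: "cle (tuple_alg N) x y \<longleftrightarrow> (\<forall>i<N. x i \<le> y i)"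
  by (auto simp: cle_def positives_tuple_alg)

section \<open>Real functions as maps on the positive cone of the complex numbers\<close>

definition scalar :: "real \<Rightarrow> point" where
  "scalar r = (\<lambda>i. if i = 0 then complex_of_real r else 0)"

definition lift :: "(real \<Rightarrow> real) \<Rightarrow> point \<Rightarrow> point" where
  "lift g x = scalar (g (Re (x 0)))"

lemma lift_scalar [simp]: "lift g (scalar r) = scalar (g r)"
  by (simp add: lift_def scalar_def)

lemma positives_complex: "positives (tuple_alg (Suc 0)) = scalar ` {0..}"
proof -
  have "a \<in> scalar ` {0..}" if "\<forall>i\<ge>1. a i = 0" "0 \<le> a 0" for a
    using that
    by (intro image_eqI[of _ _ "Re (a 0)"])
      (auto simp: scalar_def less_eq_complex_def complex_eq_iff fun_eq_iff)
  then show ?thesis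
    by (auto simp: positives_tuple_alg) (auto simp: scalar_def less_eq_complex_def)
qed

lemma cle_scalar [simp]: "cle (tuple_alg (Suc 0)) (scalar r) (scalar s) \<longleftrightarrow> r \<le> s"
  by (simp add: cle_tuple_alg scalar_def less_eq_complex_def)

lemma scalar_simps [simp]:
  "scalar r \<otimes>\<^bsub>tuple_alg (Suc 0)\<^esub> scalar s = scalar (r * s)"
  "scalar r \<oplus>\<^bsub>tuple_alg (Suc 0)\<^esub> scalar s = scalar (r + s)"
  "complex_of_real t \<odot>\<^bsub>tuple_alg (Suc 0)\<^esub> scalar r = scalar (t * r)"
  "nrm (tuple_alg (Suc 0)) (scalar r) = \<bar>r\<bar>"
  by (auto simp: scalar_def fun_eq_iff) (simp add: tuple_alg_def lessThan_Suc)

lemma lift_positives: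
  "(\<And>x. 0 \<le> x \<Longrightarrow> 0 \<le> g x)
    \<Longrightarrow> lift g \<in> positives (tuple_alg (Suc 0)) \<rightarrow> positives (tuple_alg (Suc 0))"
  by (auto simp: positives_complex)

text \<open>Positive elements are exactly the \<open>scalar r\<close> with \<open>r \<ge> 0\<close>,
  and there \<open>lift g\<close> and the order act as on reals. The next two criteria arise
  likewise.\<close>

lemma cstar_monotone_lift:
  "cstar_monotone (tuple_alg (Suc 0)) (lift g) \<longleftrightarrow> (\<forall>x\<ge>0. \<forall>y\<ge>0. x \<le> y \<longrightarrow> g x \<le> g y)"
  unfolding cstar_monotone_def positives_complex by (auto simp del: tuple_alg_simps)

lemma cstar_supercongruent_lift:
  "cstar_supercongruent (tuple_alg (Suc 0)) (lift g)
    \<longleftrightarrow> (\<forall>a\<ge>0. \<forall>c\<ge>0. c \<le> 1 \<longrightarrow> c * g a * c \<le> g (c * a * c))"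
  by (auto simp: cstar_supercongruent_def positives_complex simp del: tuple_alg_simps)

lemma cstar_concave_lift:
  "cstar_concave (tuple_alg (Suc 0)) (lift g)
    \<longleftrightarrow> (\<forall>x\<ge>0. \<forall>y\<ge>0. \<forall>t\<in>{0..1}. t * g x + (1 - t) * g y \<le> g (t * x + (1 - t) * y))"
  unfolding cstar_concave_def positives_complex by (auto simp del: tuple_alg_simps of_real_diff)

section \<open>The four examples\<close>

text \<open>\<open>1 - i\<close> exchanges the indices 0 and 1.\<close>

definition swap :: "point \<Rightarrow> point" where
  "swap x = (\<lambda>i. if i < 2 then x (1 - i) else 0)"

lemma swap_positives: "swap \<in> positives (tuple_alg 2) \<rightarrow> positives (tuple_alg 2)"
  by (auto simp: swap_def positives_tuple_alg)

lemma cstar_concave_swap: "cstar_concave (tuple_alg 2) swap"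
  by (auto simp: cstar_concave_def cle_tuple_alg swap_def)

lemma not_cstar_supercongruent_swap: "\<not> cstar_supercongruent (tuple_alg 2) swap"
proof
  define c :: point where "c i = (if i = 0 then 1 else 0)" for i
  define a :: point where "a i = (if i = 1 then 1 else 0)" for i
  assume "cstar_supercongruent (tuple_alg 2) swap"
  moreover have "c \<in> positives (tuple_alg 2)" "a \<in> positives (tuple_alg 2)"
    by (auto simp: positives_tuple_alg c_def a_def less_eq_complex_def)
  moreover have "nrm (tuple_alg 2) c \<le> 1"
    by (simp add: nrm_tuple_alg_le_iff c_def)
  ultimately have "cle (tuple_alg 2) ((c \<otimes>\<^bsub>tuple_alg 2\<^esub> swap a) \<otimes>\<^bsub>tuple_alg 2\<^esub> c)
      (swap ((c \<otimes>\<^bsub>tuple_alg 2\<^esub> a) \<otimes>\<^bsub>tuple_alg 2\<^esub> c))"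
    unfolding cstar_supercongruent_def by blast
  \<comment> \<open>Compare entry 0: \<open>c\<close> and \<open>a\<close> have disjoint supports,
    so the right side is 0, while \<open>swap a = c\<close> makes the left side 1.\<close>
  then have "(1 :: complex) \<le> 0"
    unfolding cle_tuple_alg by (auto simp: swap_def a_def c_def dest: spec[of _ 0])
  then show False by (simp add: less_eq_complex_def)
qed

lemma lift_square:
  "cstar_monotone (tuple_alg (Suc 0)) (lift (\<lambda>x. x\<^sup>2))"
  "\<not> cstar_concave (tuple_alg (Suc 0)) (lift (\<lambda>x. x\<^sup>2))"
  "\<not> cstar_supercongruent (tuple_alg (Suc 0)) (lift (\<lambda>x. x\<^sup>2))"
proof -
  show "cstar_monotone (tuple_alg (Suc 0)) (lift (\<lambda>x. x\<^sup>2))"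
    by (simp add: cstar_monotone_lift)
  show "\<not> cstar_concave (tuple_alg (Suc 0)) (lift (\<lambda>x. x\<^sup>2))"
    \<comment> \<open>At the midpoint of 0 and 2 concavity would give
      \<open>2 \<le> 1\<close>.\<close>
    using cstar_concave_lift[THEN iffD1, rule_format, of "\<lambda>x. x\<^sup>2" 0 2 "1/2"] by auto
  show "\<not> cstar_supercongruent (tuple_alg (Suc 0)) (lift (\<lambda>x. x\<^sup>2))"
    \<comment> \<open>With \<open>a = 1\<close> and \<open>c = 1/2\<close> the claim would be
      \<open>1/4 \<le> 1/16\<close>.\<close>
    using cstar_supercongruent_lift[THEN iffD1, rule_format, of "\<lambda>x. x\<^sup>2" 1 "1/2"]
    by (auto simp: power2_eq_square)
qed

lemma lift_indicator_0:
  "\<not> cstar_monotone (tuple_alg (Suc 0)) (lift (indicator {0}))"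
  "cstar_supercongruent (tuple_alg (Suc 0)) (lift (indicator {0}))"
proof -
  show "\<not> cstar_monotone (tuple_alg (Suc 0)) (lift (indicator {0}))"
    using cstar_monotone_lift[THEN iffD1, rule_format, of "indicator {0}" 0 1] by auto
  show "cstar_supercongruent (tuple_alg (Suc 0)) (lift (indicator {0}))"
    \<comment> \<open>For \<open>a = 0\<close> the inequality is \<open>c * c \<le> 1\<close>; for
      \<open>a > 0\<close> its left side vanishes.\<close>
    by (auto simp: cstar_supercongruent_lift indicator_def mult_le_one)
qed

lemma lift_indicator_1:
  "\<not> cstar_monotone (tuple_alg (Suc 0)) (lift (indicator {1}))"
  "\<not> cstar_supercongruent (tuple_alg (Suc 0)) (lift (indicator {1}))"
proof -
  show "\<not> cstar_monotone (tuple_alg (Suc 0)) (lift (indicator {1}))"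
    using cstar_monotone_lift[THEN iffD1, rule_format, of "indicator {1}" 1 2] by auto
  show "\<not> cstar_supercongruent (tuple_alg (Suc 0)) (lift (indicator {1}))"
    \<comment> \<open>Compression moves 1 to \<open>1/4\<close>, off the support, so the claim would
      be \<open>1/4 \<le> 0\<close>.\<close>
    using cstar_supercongruent_lift[THEN iffD1, rule_format, of "indicator {1}" 1 "1/2"] by auto
qed

theorem proposition3p5:
  shows "(\<exists>(A :: point cstar) \<phi>. cstar_algebra A \<and> \<phi> \<in> positives A \<rightarrow> positives A \<and>
            cstar_concave A \<phi> \<and> \<not> cstar_supercongruent A \<phi>) \<and>
         (\<exists>(A :: point cstar) \<phi>. cstar_algebra A \<and> \<phi> \<in> positives A \<rightarrow> positives A \<and>
            cstar_monotone A \<phi> \<and> \<not> cstar_concave A \<phi> \<and> \<not> cstar_supercongruent A \<phi>) \<and>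
         (\<exists>(A :: point cstar) \<phi>. cstar_algebra A \<and> \<phi> \<in> positives A \<rightarrow> positives A \<and>
            \<not> cstar_monotone A \<phi> \<and> cstar_supercongruent A \<phi>) \<and>
         (\<exists>(A :: point cstar) \<phi>. cstar_algebra A \<and> \<phi> \<in> positives A \<rightarrow> positives A \<and>
            \<not> cstar_monotone A \<phi> \<and> \<not> cstar_supercongruent A \<phi>)"
proof (intro conjI, goal_cases)
  case 1
  show ?case
    using cstar_algebra_tuple_alg swap_positives cstar_concave_swap not_cstar_supercongruent_swap
    by blast
next
  case 2
  show ?case
    by (intro exI[of _ "tuple_alg (Suc 0)"] exI[of _ "lift (\<lambda>x. x\<^sup>2)"] conjI
        cstar_algebra_tuple_alg lift_positives lift_square) simp
next
  case 3
  show ?case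
    by (intro exI[of _ "tuple_alg (Suc 0)"] exI[of _ "lift (indicator {0})"] conjI
        cstar_algebra_tuple_alg lift_positives lift_indicator_0) simp
next
  case 4
  show ?case
    by (intro exI[of _ "tuple_alg (Suc 0)"] exI[of _ "lift (indicator {1})"] conjI
        cstar_algebra_tuple_alg lift_positives lift_indicator_1) simp
qed

end
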